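(* Let $\mathbb{D}\subset\mathbb{H}$ be convex and compact, and let $\mathbf{T}^\ell:\mathbb{D}\to\mathbb{D}$, $\ell\in\mathbb{N}$, be operators that are $\alpha$-averaged for all $\ell\in\mathbb{N}$, with a common $\alpha\in(0,1)$. Suppose there exists $\sigma\ge0$ such that, given $\bar{\mathbf{x}}^\ell\in\mathrm{fix}(\mathbf{T}^\ell)$ with $\ell\ge1$, $$\inf_{\bar{\mathbf{x}}^{\ell-1}\in\mathrm{fix}(\mathbf{T}^{\ell-1})}\|\bar{\mathbf{x}}^\ell-\bar{\mathbf{x}}^{\ell-1}\|\le\sigma.$$ Let $\mathbf{u}^\ell=(u_1^\ell,\ldots,u_n^\ell)$, $\ell\in\mathbb{N}$, be $\{0,1\}^n$-valued random vectors with $p_i:=\mathbb{P}[u_i^\ell=1]>0$ for $i\in\{1,\ldots,n\}$ (no independence among the components of $\mathbf{u}^\ell$ is required). Let $\mathbf{e}^\ell=(e_1^\ell,\ldots,e_n^\ell)$, $\ell\in\mathbb{N}$, be $\mathbb{H}$-valued random vectors (additive errors) with $\mathbb{E}[\|\mathbf{e}^\ell\|^2]\le\nu^2$ for a constant $\nu\ge0$. Assume that the random processes $\{\mathbf{u}^\ell\}_{\ell\in\mathbb{N}}$ and $\{\mathbf{e}^\ell\}_{\ell\in\mathbb{N}}$ are i.i.d. and independent of each other. Let $\{\mathbf{x}^\ell\}_{\ell\in\mathbb{N}}$ be the sequence generated, from a deterministic initial condition $\mathbf{x}^0\in\mathbb{H}$, by $$x_i^{\ell+1}=(1-u_i^\ell)\,x_i^\ell+u_i^\ell\left(\mathbf{T}_i^{\ell+1}\mathbf{x}^\ell+e_i^\ell\right),\qquad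 i\in\{1,\ldots,n\},\ \ell\in\mathbb{N}.$$ Then, for any $\ell\in\mathbb{N}$, $$\mathbb{E}\left[\frac{1}{\ell+1}\sum_{h=0}^{\ell}\|(\mathbf{I}-\mathbf{T}^{h+1})\mathbf{x}^h\|^2\right]\le\frac{\alpha}{\underline p(1-\alpha)}\left(\frac{1}{\ell+1}\|\mathbf{x}^0-\bar{\mathbf{x}}^0\|^2+\sigma^2+\nu^2+2\,\mathrm{diam}(\mathbb{D})(\sigma+\nu)\right),$$ where $\underline p:=\min_i p_i$ and $\bar{\mathbf{x}}^0\in\mathrm{fix}(\mathbf{T}^0)$.
   Context: $\mathbb{H}=\mathbb{H}_1\oplus\cdots\oplus\mathbb{H}_n$ is a direct sum of (possibly infinite-dimensional) Hilbert spaces $\mathbb{H}_i$ with inner products $\langle\cdot,\cdot\rangle_i$ and induced norms $\|\cdot\|_i$. Its elements are $\mathbf{x}=(x_1,\ldots,x_n)$ with $x_i\in\mathbb{H}_i$, its inner product is $\langle\mathbf{x},\mathbf{y}\rangle=\sum_{i=1}^n\langle x_i,y_i\rangle_i$, and $\|\cdot\|$ is the induced norm. Operators are written in components as $\mathbf{T}\mathbf{x}=(\mathbf{T}_1\mathbf{x},\ldots,\mathbf{T}_n\mathbf{x})$ with $\mathbf{T}_i$ taking values in $\mathbb{H}_i$, and $\mathbf{I}$ is the identity. $\mathbf{T}$ is $\alpha$-averaged, $\alpha\in(0,1)$, if $\mathbf{T}=(1-\alpha)\mathbf{I}+\alpha\mathbf{R}$ for some non-expansive ($1$-Lipschitz)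 operator $\mathbf{R}$. Equivalently, $\|\mathbf{T}\mathbf{x}-\mathbf{T}\mathbf{y}\|^2\le\|\mathbf{x}-\mathbf{y}\|^2-\frac{1-\alpha}{\alpha}\|(\mathbf{I}-\mathbf{T})\mathbf{x}-(\mathbf{I}-\mathbf{T})\mathbf{y}\|^2$ for all $\mathbf{x},\mathbf{y}$ in the domain. $\mathrm{fix}(\mathbf{T})=\{\mathbf{x}:\mathbf{x}=\mathbf{T}\mathbf{x}\}$ is the set of fixed points, $\mathrm{diam}(\mathbb{D})$ is the diameter of $\mathbb{D}$, and $\mathbb{N}$ includes $0$. All random variables live on one probability space $(\Omega,\mathcal{F},\mathbb{P})$.
   Formalization: The bound fails for some fixed points of T^0, so x̄^0 is taken to be the start of a sequence of fixed points x̄^l of T^l with steps at most σ (such a sequence is proved to exist); the iterates x^l are assumed to stay in D, where the operators are defined. *)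

theory Defs
  imports "HOL-Probability.Probability"
begin

text \<open>
  A finite family of (possibly different) Hilbert spaces is represented as a family of complete
  subspaces \<open>V i\<close> of one real inner product space. Their direct sum is a subspace of
  \<^typ>\<open>'a^'n\<close>, whose library inner product is the sum of the componentwise inner products.
\<close>

definition hilbert_sum :: "('n::finite \<Rightarrow> 'a::real_inner set) \<Rightarrow> ('a^'n) set" where
  "hilbert_sum V = {x. \<forall>i. x $ i \<in> V i}"

text \<open>
  Operators with domain \<open>D\<close> are total functions of which only the values on \<open>D\<close> matter.
\<close>

definition averaged_on :: "'b::real_normed_vector set \<Rightarrow> real \<Rightarrow> ('b \<Rightarrow> 'b) \<Rightarrow> bool" where
  "averaged_on D \<alpha> T \<longleftrightarrow>
     (\<exists>R. 1-lipschitz_on D R \<and> (\<forall>x\<in>D. T x = (1 - \<alpha>) *\<^sub>R x + \<alpha> *\<^sub>R R x))"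

definition fix_on :: "'b set \<Rightarrow> ('b \<Rightarrow> 'b) \<Rightarrow> 'b set" where
  "fix_on D T = {x \<in> D. T x = x}"

text \<open>
  The drift condition bounds the distance from any fixed point of \<open>T l\<close> to the fixed points of
  \<open>T (l - 1)\<close>, but not conversely: a fixed point of \<open>T 0\<close> may be far from all fixed points of
  \<open>T 1\<close>. The admissible reference points in \<open>fix_on D (T 0)\<close> are therefore those
  from which the fixed points can be followed with steps of length at most \<open>\<sigma>\<close>.
\<close>

definition fix_path ::
    "'b::real_normed_vector set \<Rightarrow> (nat \<Rightarrow> 'b \<Rightarrow> 'b) \<Rightarrow> real \<Rightarrow> (nat \<Rightarrow> 'b) \<Rightarrow> bool" where
  "fix_path D T \<sigma> xbar \<longleftrightarrow>
     (\<forall>l. xbar l \<in> fix_on D (T l)) \<and> (\<forall>l\<ge>1. norm (xbar l - xbar (l - 1)) \<le> \<sigma>)"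

text \<open>
  Independence of two random elements. The library's \<open>indep_var\<close> requires both to have values of
  the same type; this is its characterisation \<open>indep_var_eq\<close> without that restriction.
\<close>

definition indep_pair ::
    "'w measure \<Rightarrow> 'b measure \<Rightarrow> ('w \<Rightarrow> 'b) \<Rightarrow> 'c measure \<Rightarrow> ('w \<Rightarrow> 'c) \<Rightarrow> bool" where
  "indep_pair M N X N' Y \<longleftrightarrow>
     X \<in> measurable M N \<and> Y \<in> measurable M N' \<and>
     prob_space.indep_set M
       (sigma_sets (space M) {X -` A \<inter> space M | A. A \<in> sets N})
       (sigma_sets (space M) {Y -` A \<inter> space M | A. A \<in> sets N'})"

end

theory Submission
  imports Defs
begin

text \<open>
  Let \<open>F l\<close> be the expectation of \<open>\<Sum>i. (norm (x l $ i - xbar l $ i))\<^sup>2 / p i\<close>. Since \<open>u l\<close> is independent of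
  \<open>(x l, e l)\<close>, the weights turn the random partial update into the full one: passing from \<open>x l\<close> to
  \<open>x (l + 1)\<close> replaces the contribution of \<open>(norm (x l - xbar (l + 1)))\<^sup>2\<close> by that of
  \<open>(norm (T (l + 1) (x l) + e l - xbar (l + 1)))\<^sup>2\<close>, and averagedness makes this a decrease by
  \<open>(1 - \<alpha>) / \<alpha>\<close> times the squared residual, up to the error \<open>2 * diameter D * \<nu> + \<nu>\<^sup>2\<close>. The drift from \<open>xbar l\<close> to
  \<open>xbar (l + 1)\<close> costs at most \<open>2 * diameter D * \<sigma> + \<sigma>\<^sup>2\<close> divided by the smallest \<open>p i\<close>.
  The bound is the telescoped sum of these estimates.
\<close>

section \<open>Averaged operators, fixed points and paths of fixed points\<close>

text \<open>With \<open>a = x - y\<close> and \<open>b = R x - R y\<close>, the squared norm of the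
  convex combination of \<open>a\<close> and \<open>b\<close> is the convex combination of their
  squared norms minus \<open>\<alpha> * (1 - \<alpha>) * (norm (a - b))\<^sup>2\<close>.
  Nonexpansiveness of \<open>R\<close> replaces \<open>norm b\<close> by \<open>norm a\<close>, and
  the displacement difference is exactly \<open>\<alpha> *\<^sub>R (a - b)\<close>.\<close>

lemma averaged_on_norm_le:
  fixes T :: "'b::real_inner \<Rightarrow> 'b"
  assumes T: "averaged_on D \<alpha> T" and \<alpha>: "0 < \<alpha>" "\<alpha> < 1" and xy: "x \<in> D" "y \<in> D"
  shows "(norm (T x - T y))\<^sup>2 \<le>
           (norm (x - y))\<^sup>2 - (1 - \<alpha>) / \<alpha> * (norm ((x - T x) - (y - T y)))\<^sup>2"
proof -
  obtain R where R: "1-lipschitz_on D R" and eq: "\<And>x. x \<in> D \<Longrightarrow> T x = (1 - \<alpha>) *\<^sub>R x + \<alpha> *\<^sub>R R x"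
    using T unfolding averaged_on_def by blast
  define a b where "a = x - y" and "b = R x - R y"
  have "norm b \<le> norm a"
    using lipschitz_onD[OF R xy] unfolding a_def b_def by (simp add: dist_norm)
  then have ba: "(norm b)\<^sup>2 \<le> (norm a)\<^sup>2"
    by (simp add: power_mono)
  have 1: "T x - T y = (1 - \<alpha>) *\<^sub>R a + \<alpha> *\<^sub>R b"
    and 2: "(x - T x) - (y - T y) = \<alpha> *\<^sub>R (a - b)"
    using xy by (simp_all add: eq a_def b_def algebra_simps)
  have "(norm (T x - T y))\<^sup>2 =
      (1 - \<alpha>) * (norm a)\<^sup>2 + \<alpha> * (norm b)\<^sup>2 - \<alpha> * (1 - \<alpha>) * (norm (a - b))\<^sup>2"
    unfolding 1 power2_norm_eq_inner
    by (simp add: inner_simps inner_commute algebra_simps power2_eq_square)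
  also have "\<dots> \<le> (norm a)\<^sup>2 - \<alpha> * (1 - \<alpha>) * (norm (a - b))\<^sup>2"
    using mult_left_mono[OF ba, of \<alpha>] \<alpha> by (simp add: algebra_simps)
  also have "\<alpha> * (1 - \<alpha>) * (norm (a - b))\<^sup>2 = (1 - \<alpha>) / \<alpha> * (norm (\<alpha> *\<^sub>R (a - b)))\<^sup>2"
    using \<alpha> by (simp add: power_mult_distrib power2_eq_square)
  finally show ?thesis
    unfolding 2 by (simp add: a_def)
qed

lemma averaged_on_nonexpansive:
  fixes T :: "'b::real_inner \<Rightarrow> 'b"
  assumes "averaged_on D \<alpha> T" "0 < \<alpha>" "\<alpha> < 1"
  shows "1-lipschitz_on D T"
proof (rule lipschitz_onI)
  fix x y assume "x \<in> D" "y \<in> D"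
  note averaged_on_norm_le[OF assms this]
  also have "(norm (x - y))\<^sup>2 - (1 - \<alpha>) / \<alpha> * (norm ((x - T x) - (y - T y)))\<^sup>2 \<le> (norm (x - y))\<^sup>2"
    using assms by simp
  finally have "norm (T x - T y) \<le> norm (x - y)"
    by (rule power2_le_imp_le) simp
  then show "dist (T x) (T y) \<le> 1 * dist x y"
    by (simp add: dist_norm)
qed simp

lemma compact_fix_on:
  fixes T :: "'b::real_normed_vector \<Rightarrow> 'b"
  assumes "compact D" "continuous_on D T"
  shows "compact (fix_on D T)"
proof -
  have "closedin (top_of_set D) (D \<inter> (\<lambda>x. T x - x) -` {0})"
    by (intro continuous_closedin_preimage continuous_intros assms closed_singleton)
  then have "compact (D \<inter> (\<lambda>x. T x - x) -` {0})"
    using assms(1) closedin_compact by blast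
  also have "D \<inter> (\<lambda>x. T x - x) -` {0} = fix_on D T"
    by (auto simp: fix_on_def)
  finally show ?thesis .
qed

text \<open>The contractions \<open>(1 - \<epsilon>) T + \<epsilon> c\<close> have fixed points by Banach's theorem; so the infimum of
  \<open>norm (T x - x)\<close> is zero, and it is attained.\<close>

lemma nonexpansive_fix_on_nonempty:
  fixes T :: "'b::real_normed_vector \<Rightarrow> 'b"
  assumes D: "compact D" "convex D" "D \<noteq> {}" and T: "1-lipschitz_on D T" "T \<in> D \<rightarrow> D"
  shows "fix_on D T \<noteq> {}"
proof -
  obtain c where c: "c \<in> D" using D by blast
  have "continuous_on D T"
    using T(1) by (rule lipschitz_on_continuous_on)
  then have "continuous_on D (\<lambda>x. norm (T x - x))"
    by (intro continuous_intros)
  then obtain x where x: "x \<in> D" and min: "\<And>y. y \<in> D \<Longrightarrow> norm (T x - x) \<le> norm (T y - y)"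
    using continuous_attains_inf[OF D(1,3)] by blast
  have "norm (T x - x) \<le> \<epsilon> * diameter D" if \<epsilon>: "0 < \<epsilon>" "\<epsilon> < 1" for \<epsilon>
  proof -
    define f where "f y = (1 - \<epsilon>) *\<^sub>R T y + \<epsilon> *\<^sub>R c" for y
    have "\<exists>!y\<in>D. f y = y"
    proof (rule Banach_fix[where c = "1 - \<epsilon>"])
      show "f ` D \<subseteq> D"
        using convexD_alt[OF D(2), of _ c \<epsilon>] T(2) c \<epsilon> by (auto simp: f_def)
      show "dist (f y) (f z) \<le> (1 - \<epsilon>) * dist y z" if "y \<in> D" "z \<in> D" for y z
      proof -
        have "f y - f z = (1 - \<epsilon>) *\<^sub>R (T y - T z)"
          by (simp add: f_def algebra_simps)
        then have "dist (f y) (f z) = (1 - \<epsilon>) * dist (T y) (T z)"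
          using \<epsilon> by (simp add: dist_norm)
        then show ?thesis
          using lipschitz_onD[OF T(1) that] \<epsilon> by simp
      qed
    qed (use D \<epsilon> compact_imp_complete in auto)
    then obtain y where y: "y \<in> D" "f y = y" by blast
    then have "T y - y = \<epsilon> *\<^sub>R (T y - c)"
      by (simp add: f_def algebra_simps)
    then have "norm (T y - y) = \<epsilon> * dist (T y) c"
      using \<epsilon> by (simp add: dist_norm)
    also have "\<dots> \<le> \<epsilon> * diameter D"
      using diameter_bounded_bound[OF compact_imp_bounded[OF D(1)], of "T y" c] T(2) y c \<epsilon> by auto
    finally show ?thesis
      using min[OF y(1)] by simp
  qed
  then have "eventually (\<lambda>\<epsilon>. norm (T x - x) \<le> \<epsilon> * diameter D) (at_right 0)"
    by (auto simp: eventually_at_right_field intro!: exI[of _ 1])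
  moreover have "((\<lambda>\<epsilon>. \<epsilon> * diameter D) \<longlongrightarrow> 0 * diameter D) (at_right 0)"
    by (intro tendsto_intros)
  ultimately have "norm (T x - x) \<le> 0 * diameter D"
    by (intro tendsto_lowerbound) auto
  then show ?thesis
    using x by (auto simp: fix_on_def)
qed

text \<open>Finite chains are built backwards; Tychonoff's theorem yields an infinite one.\<close>

lemma compact_chain_exists:
  fixes K :: "nat \<Rightarrow> 'b::metric_space set"
  assumes K: "\<And>l. compact (K l)" "\<And>l. K l \<noteq> {}"
    and pred: "\<And>l y. y \<in> K (Suc l) \<Longrightarrow> \<exists>z\<in>K l. dist y z \<le> \<sigma>"
  shows "\<exists>y. \<forall>l. y l \<in> K l \<and> dist (y (Suc l)) (y l) \<le> \<sigma>"
proof -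
  define C where "C l = {y :: nat \<Rightarrow> 'b. dist (y (Suc l)) (y l) \<le> \<sigma>}" for l
  \<comment> \<open>The sequences are total: entries beyond \<open>N\<close> are arbitrary members
    of the sets \<open>K l\<close>, so each finite chain is already a point of the full
    product.\<close>
  have finite_chain: "\<exists>y. (\<forall>l. y l \<in> K l) \<and> y N = z \<and> (\<forall>l<N. y \<in> C l)" if "z \<in> K N" for z N
    using that
  proof (induction N arbitrary: z)
    case 0
    have "\<forall>l. \<exists>w. w \<in> K l" using K(2) by blast
    then obtain s where "\<And>l. s l \<in> K l" by metis
    then show ?case using 0 by (intro exI[of _ "s(0 := z)"]) auto
  next
    case (Suc N)
    obtain w where w: "w \<in> K N" "dist z w \<le> \<sigma>" using pred[OF Suc.prems] by blast
    obtain y where y: "\<And>l. y l \<in> K l" "y N = w" "\<And>l. l < N \<Longrightarrow> y \<in> C l" using Suc.IH[OF w(1)] by blast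
    show ?case
      using Suc.prems w y by (intro exI[of _ "y(Suc N := z)"]) (auto simp: C_def less_Suc_eq)
  qed
  have "compactin (product_topology (\<lambda>_. euclidean) UNIV) (PiE UNIV K)"
    using K(1) by (simp add: compactin_PiE)
  then have "compact (PiE UNIV K)"
    by (simp add: euclidean_product_topology)
  \<comment> \<open>Each constraint \<open>C l\<close> is closed because it involves only two
    coordinates. Finitely many constraints lie below some \<open>N\<close>, where a finite chain
    satisfies them all; compactness then gives a point satisfying every constraint.\<close>
  then have "PiE UNIV K \<inter> (\<Inter>l\<in>UNIV. C l) \<noteq> {}"
  proof (rule compact_imp_fip_image)
    show "closed (C l)" for l
      unfolding C_def by (intro closed_Collect_le continuous_intros continuous_on_product_coordinates)
    fix I' :: "nat set" assume "finite I'"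
    then obtain N where N: "I' \<subseteq> {..<N}" using finite_nat_iff_bounded by blast
    obtain z where "z \<in> K N" using K(2) by blast
    with finite_chain obtain y where "\<And>l. y l \<in> K l" "\<And>l. l < N \<Longrightarrow> y \<in> C l" by meson
    then have "y \<in> PiE UNIV K \<inter> (\<Inter>l\<in>I'. C l)" using N by auto
    then show "PiE UNIV K \<inter> (\<Inter>l\<in>I'. C l) \<noteq> {}" by blast
  qed
  then show ?thesis by (auto simp: C_def PiE_iff)
qed

text \<open>The fixed-point sets are compact and nonempty, so the infimum in the drift condition is
  attained. Every fixed point of \<open>T (Suc l)\<close> therefore has an actual predecessor within
  \<open>\<sigma>\<close>, which is what the chain lemma asks for.\<close>

lemma fix_path_exists:
  fixes T :: "nat \<Rightarrow> 'b::real_normed_vector \<Rightarrow> 'b"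
  assumes D: "compact D" "convex D" "D \<noteq> {}"
    and T: "\<And>l. 1-lipschitz_on D (T l)" "\<And>l. T l \<in> D \<rightarrow> D"
    and drift: "\<And>l xb. l \<ge> 1 \<Longrightarrow> xb \<in> fix_on D (T l) \<Longrightarrow>
                  (INF y\<in>fix_on D (T (l - 1)). norm (xb - y)) \<le> \<sigma>"
  shows "\<exists>xbar. fix_path D T \<sigma> xbar"
proof -
  have compact: "compact (fix_on D (T l))" for l
    by (rule compact_fix_on[OF D(1) lipschitz_on_continuous_on[OF T(1)]])
  have nonempty: "fix_on D (T l) \<noteq> {}" for l
    by (rule nonexpansive_fix_on_nonempty[OF D T])
  have "\<exists>xbar. \<forall>l. xbar l \<in> fix_on D (T l) \<and> dist (xbar (Suc l)) (xbar l) \<le> \<sigma>"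
  proof (rule compact_chain_exists[OF compact nonempty])
    fix l y assume y: "y \<in> fix_on D (T (Suc l))"
    obtain z where z: "z \<in> fix_on D (T l)" "\<And>w. w \<in> fix_on D (T l) \<Longrightarrow> norm (y - z) \<le> norm (y - w)"
      using continuous_attains_inf[OF compact nonempty, of l "\<lambda>z. norm (y - z)"]
        continuous_on_norm[OF continuous_on_diff[OF continuous_on_const continuous_on_id]]
      by blast
    then have "norm (y - z) \<le> (INF w\<in>fix_on D (T l). norm (y - w))"
      by (intro cINF_greatest) (use nonempty in auto)
    also have "\<dots> \<le> \<sigma>" using drift[of "Suc l" y] y by simp
    finally show "\<exists>z\<in>fix_on D (T l). dist y z \<le> \<sigma>"
      using z(1) by (auto simp: dist_norm)
  qed
  then obtain xbar where xbar: "\<And>l. xbar l \<in> fix_on D (T l)" "\<And>l. dist (xbar (Suc l)) (xbar l) \<le> \<sigma>"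
    by blast
  have "norm (xbar l - xbar (l - 1)) \<le> \<sigma>" if "l \<ge> 1" for l
    using that xbar(2)[of "l - 1"] by (simp add: dist_norm)
  then show ?thesis
    using xbar(1) unfolding fix_path_def by blast
qed

section \<open>Borel measurability of the iterates in possibly non-separable spaces\<close>

text \<open>The operators are continuous on \<open>D\<close> only, so the composition passes through
  the Borel space restricted to \<open>D\<close>.\<close>

lemma borel_measurable_compose_on:
  assumes "continuous_on D f" "X \<in> borel_measurable N" "X \<in> space N \<rightarrow> D"
  shows "(\<lambda>\<omega>. f (X \<omega>)) \<in> borel_measurable N"
  by (rule measurable_compose[OF measurable_restrict_space2[OF assms(3,2)]
        borel_measurable_continuous_on_restrict[OF assms(1)]])

text \<open>In a non-separable space the sum of two Borel functions need not be Borel; it is if one of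
  them has compact range, since that one is a uniform limit of Borel functions with finite range.\<close>

lemma borel_measurable_add_compact:
  fixes f g :: "'w \<Rightarrow> 'b::real_normed_vector"
  assumes f: "f \<in> borel_measurable N" and g: "g \<in> borel_measurable N"
    and K: "compact K" "g \<in> space N \<rightarrow> K"
  shows "(\<lambda>\<omega>. f \<omega> + g \<omega>) \<in> borel_measurable N"
proof -
  have "\<exists>cs. K \<subseteq> (\<Union>c\<in>set cs. ball c \<epsilon>)" if "\<epsilon> > 0" for \<epsilon>
    using K(1) that unfolding compact_eq_totally_bounded by (metis finite_list)
  then have "\<forall>n. \<exists>cs. K \<subseteq> (\<Union>c\<in>set cs. ball c (inverse (real (Suc n))))"
    by simp
  then obtain cs where cs: "\<And>n. K \<subseteq> (\<Union>c\<in>set (cs n). ball c (inverse (real (Suc n))))"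
    by metis
  \<comment> \<open>\<open>J n \<omega>\<close> is the first centre in the list closer to
    \<open>g \<omega>\<close> than \<open>1 / (n + 1)\<close>. On \<open>space N\<close> such a
    centre exists, and the least index does not exceed a valid one, so the unspecified values of
    \<open>nth\<close> past the end of the list do no harm.\<close>
  define J where "J n \<omega> = (LEAST j. dist (cs n ! j) (g \<omega>) < inverse (real (Suc n)))" for n \<omega>
  have J: "J n \<in> measurable N (count_space UNIV)" for n
    unfolding J_def
  proof (rule measurable_Least)
    fix j
    have [measurable]: "(\<lambda>\<omega>. dist (cs n ! j) (g \<omega>)) \<in> borel_measurable N"
      by (rule borel_measurable_continuous_on[OF continuous_on_dist[OF continuous_on_const continuous_on_id] g])
    show "Measurable.pred N (\<lambda>\<omega>. dist (cs n ! j) (g \<omega>) < inverse (real (Suc n)))"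
      by measurable
  qed
  \<comment> \<open>For a fixed index the second summand is a constant and the sum is a translate of
    \<open>f\<close>; the index ranges over a countable set.\<close>
  have "(\<lambda>\<omega>. f \<omega> + cs n ! J n \<omega>) \<in> borel_measurable N" for n
    by (rule measurable_compose_countable[OF borel_measurable_continuous_on
          [OF continuous_on_add[OF continuous_on_id continuous_on_const] f] J])
  moreover have "(\<lambda>n. f \<omega> + cs n ! J n \<omega>) \<longlonglongrightarrow> f \<omega> + g \<omega>" if "\<omega> \<in> space N" for \<omega>
  proof (rule tendsto_add[OF tendsto_const], rule LIM_zero_cancel,
      rule Lim_null_comparison[OF _ LIMSEQ_inverse_real_of_nat])
    have "dist (cs n ! J n \<omega>) (g \<omega>) < inverse (real (Suc n))" for n
    proof -
      have "g \<omega> \<in> K"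
        using K(2) that by blast
      then obtain c where "c \<in> set (cs n)" "dist c (g \<omega>) < inverse (real (Suc n))"
        using cs[of n] unfolding subset_iff UN_iff mem_ball by blast
      then have "\<exists>j. dist (cs n ! j) (g \<omega>) < inverse (real (Suc n))"
        by (metis in_set_conv_nth)
      then show ?thesis unfolding J_def by (rule LeastI_ex)
    qed
    then show "\<forall>\<^sub>F n in sequentially. norm (cs n ! J n \<omega> - g \<omega>) \<le> inverse (real (Suc n))"
      by (simp add: dist_norm less_imp_le)
  qed
  ultimately show ?thesis
    by (rule borel_measurable_LIMSEQ_metric)
qed

text \<open>There are finitely many update patterns, and \<open>u\<close> determines the pattern
  measurably. For a fixed pattern \<open>J\<close> the new iterate is the sum of
  \<open>S X + e\<close> cut down to \<open>J\<close> and \<open>X\<close> cut down to the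
  complement. Both are continuous images of measurable functions and the second has compact range,
  so their sum is again measurable.\<close>

lemma borel_measurable_async_step:
  fixes u :: "'w \<Rightarrow> real^'n::finite" and X Y e :: "'w \<Rightarrow> 'a::real_inner^'n"
  assumes D: "compact D" "continuous_on D S"
    and X: "X \<in> borel_measurable N" "X \<in> space N \<rightarrow> D"
    and u: "u \<in> borel_measurable N" "\<And>\<omega> i. \<omega> \<in> space N \<Longrightarrow> u \<omega> $ i \<in> {0, 1}"
    and e: "e \<in> borel_measurable N"
    and Y: "\<And>\<omega> i. \<omega> \<in> space N \<Longrightarrow> Y \<omega> $ i =
              (1 - u \<omega> $ i) *\<^sub>R (X \<omega> $ i) + (u \<omega> $ i) *\<^sub>R (S (X \<omega>) $ i + e \<omega> $ i)"
  shows "Y \<in> borel_measurable N"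
proof -
  define mask where "mask I v = (\<chi> i. if i \<in> I then v $ i else 0)" for I :: "'n set" and v :: "'a^'n"
  have mask: "continuous_on A (mask I)" for I A
    unfolding mask_def
  proof (intro continuous_on_vec_lambda)
    show "continuous_on A (\<lambda>v. if i \<in> I then v $ i else 0)" for i
      by (cases "i \<in> I") (auto intro!: continuous_intros)
  qed
  define I where "I \<omega> = {i. u \<omega> $ i = 1}" for \<omega>
  have I: "I \<in> measurable N (count_space UNIV)"
  proof (subst measurable_count_space_eq2, simp, safe)
    fix J
    have [measurable]: "(\<lambda>\<omega>. u \<omega> $ i) \<in> borel_measurable N" for i
      by (rule borel_measurable_continuous_on[OF continuous_on_component[OF continuous_on_id] u(1)])
    have "I -` {J} \<inter> space N = {\<omega> \<in> space N. \<forall>i. i \<in> J \<longleftrightarrow> u \<omega> $ i = 1}"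
      by (auto simp: I_def)
    also have "\<dots> \<in> sets N" by measurable
    finally show "I -` {J} \<inter> space N \<in> sets N" .
  qed auto
  have SX: "(\<lambda>\<omega>. S (X \<omega>)) \<in> borel_measurable N"
    by (rule borel_measurable_compose_on[OF D(2) X])
  \<comment> \<open>\<open>S (X \<omega>)\<close> stands second because it is the summand with
    compact range.\<close>
  have "(\<lambda>\<omega>. e \<omega> + S (X \<omega>)) \<in> borel_measurable N"
    by (rule borel_measurable_add_compact[OF e SX compact_continuous_image[OF D(2,1)]]) (use X in auto)
  then have Z: "(\<lambda>\<omega>. S (X \<omega>) + e \<omega>) \<in> borel_measurable N"
    by (simp add: add.commute)
  have "(\<lambda>\<omega>. mask J (S (X \<omega>) + e \<omega>) + mask (- J) (X \<omega>)) \<in> borel_measurable N" for J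
    using X
    by (intro borel_measurable_add_compact[OF _ _ compact_continuous_image[OF mask D(1)]]
        borel_measurable_continuous_on[OF mask] Z) auto
  then have "(\<lambda>\<omega>. mask (I \<omega>) (S (X \<omega>) + e \<omega>) + mask (- I \<omega>) (X \<omega>)) \<in> borel_measurable N"
    by (rule measurable_compose_countable'[OF _ I]) auto
  moreover have "Y \<omega> = mask (I \<omega>) (S (X \<omega>) + e \<omega>) + mask (- I \<omega>) (X \<omega>)" if "\<omega> \<in> space N" for \<omega>
  proof (subst vec_eq_iff, rule allI)
    fix i
    show "Y \<omega> $ i = (mask (I \<omega>) (S (X \<omega>) + e \<omega>) + mask (- I \<omega>) (X \<omega>)) $ i"
      using Y[OF that, of i] u(2)[OF that, of i] by (auto simp: mask_def I_def)
  qed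
  ultimately show ?thesis
    by (simp cong: measurable_cong)
qed

section \<open>Integrability, and independence of an update from the past\<close>

context prob_space
begin

lemma integrable_continuous_on_compact:
  fixes f :: "'b::topological_space \<Rightarrow> real"
  assumes "compact D" "continuous_on D f" "X \<in> borel_measurable M" "X \<in> space M \<rightarrow> D"
  shows "integrable M (\<lambda>\<omega>. f (X \<omega>))"
proof -
  obtain B where "\<And>y. y \<in> f ` D \<Longrightarrow> norm y \<le> B"
    using compact_imp_bounded[OF compact_continuous_image[OF assms(2,1)]] by (auto simp: bounded_iff)
  then show ?thesis
    using assms by (intro integrable_const_bound[of _ B] borel_measurable_compose_on[OF assms(2-4)]) auto
qed

text \<open>The variance of \<open>norm (e \<omega>)\<close> is nonnegative, so the squared mean is
  at most the second moment.\<close>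

lemma expectation_norm_le:
  assumes "e \<in> borel_measurable M" "integrable M (\<lambda>\<omega>. (norm (e \<omega>))\<^sup>2)"
    and "expectation (\<lambda>\<omega>. (norm (e \<omega>))\<^sup>2) \<le> \<nu>\<^sup>2" "\<nu> \<ge> 0"
  shows "integrable M (\<lambda>\<omega>. norm (e \<omega>))" "expectation (\<lambda>\<omega>. norm (e \<omega>)) \<le> \<nu>"
proof -
  show int: "integrable M (\<lambda>\<omega>. norm (e \<omega>))"
    by (rule square_integrable_imp_integrable[OF borel_measurable_continuous_on[OF continuous_on_norm_id assms(1)] assms(2)])
  have "(expectation (\<lambda>\<omega>. norm (e \<omega>)))\<^sup>2 \<le> \<nu>\<^sup>2"
    using variance_positive[of "\<lambda>\<omega>. norm (e \<omega>)"] variance_eq[OF int assms(2)] assms(3) by simp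
  then show "expectation (\<lambda>\<omega>. norm (e \<omega>)) \<le> \<nu>"
    using assms(4) by (rule power2_le_imp_le)
qed

text \<open>Independence from the whole of \<open>sets N\<close> lets one hypothesis serve every
  \<open>N\<close>-measurable quantity. As \<open>\<phi>\<close> and \<open>g\<close> are both
  real-valued, the preimages of Borel sets form Int-stable families, and the claim becomes the
  product rule for \<open>indep_var\<close>.\<close>

lemma indep_set_expectation_mult:
  fixes g \<phi> :: "'a \<Rightarrow> real"
  assumes indep: "indep_set \<A> (sets N)" "space N = space M" "\<And>A. A \<in> sets borel \<Longrightarrow> \<phi> -` A \<inter> space M \<in> \<A>"
    and g: "g \<in> borel_measurable N" and int: "integrable M \<phi>" "integrable M g"
  shows "integrable M (\<lambda>\<omega>. \<phi> \<omega> * g \<omega>)"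
    and "expectation (\<lambda>\<omega>. \<phi> \<omega> * g \<omega>) = expectation \<phi> * expectation g"
proof -
  have stable: "Int_stable {f -` A \<inter> space M |A. A \<in> sets borel}" for f :: "'a \<Rightarrow> real"
  proof (rule Int_stableI, safe)
    fix A B :: "real set" assume "A \<in> sets borel" "B \<in> sets borel"
    then show "\<exists>C. (f -` A \<inter> space M) \<inter> (f -` B \<inter> space M) = f -` C \<inter> space M \<and> C \<in> sets borel"
      by (intro exI[of _ "A \<inter> B"]) auto
  qed
  have "indep_set {\<phi> -` A \<inter> space M |A. A \<in> sets borel} {g -` A \<inter> space M |A. A \<in> sets borel}"
    using indep(1,3) measurable_sets[OF g] unfolding indep_sets2_eq indep(2) by blast
  note indep_set_sigma_sets[OF this stable stable]
  then have "indep_var borel \<phi> borel g"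
    using int by (simp add: indep_var_eq borel_measurable_integrable)
  then show "integrable M (\<lambda>\<omega>. \<phi> \<omega> * g \<omega>)"
    and "expectation (\<lambda>\<omega>. \<phi> \<omega> * g \<omega>) = expectation \<phi> * expectation g"
    using int by (simp_all add: indep_var_integrable indep_var_lebesgue_integral)
qed

text \<open>\<open>N\<close> collects the updates before \<open>l\<close> and the entire error
  process, so that in the application both \<open>x l\<close> and \<open>e l\<close> are
  \<open>N\<close>-measurable. On rectangles, independence of \<open>u l\<close> from
  \<open>N\<close> combines independence of \<open>u l\<close> from the earlier updates with
  independence of the two processes. The rectangles are Int-stable, so it extends to the
  \<sigma>-algebra they generate.\<close>

lemma past_independent:
  fixes u :: "nat \<Rightarrow> 'a \<Rightarrow> 'b::topological_space" and e :: "nat \<Rightarrow> 'a \<Rightarrow> 'c::topological_space"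
  assumes u: "indep_vars (\<lambda>_. borel) u UNIV"
    and ue: "indep_pair M (Pi\<^sub>M UNIV (\<lambda>_::nat. borel)) (\<lambda>\<omega> l. u l \<omega>)
               (Pi\<^sub>M UNIV (\<lambda>_::nat. borel)) (\<lambda>\<omega> l. e l \<omega>)"
  obtains N where "space N = space M" "\<And>k. k < l \<Longrightarrow> u k \<in> borel_measurable N"
    "\<And>k. e k \<in> borel_measurable N"
    "indep_set {u l -` A \<inter> space M |A. A \<in> sets borel} (sets N)"
proof -
  let ?P = "\<lambda>J. Pi\<^sub>M J (\<lambda>_::nat. borel :: 'b measure)"
  let ?Q = "Pi\<^sub>M UNIV (\<lambda>_::nat. borel :: 'c measure)"
  define R where "R \<omega> = restrict (\<lambda>k. u k \<omega>) {..<l}" for \<omega>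
  define R1 where "R1 \<omega> = restrict (\<lambda>k. u k \<omega>) {l}" for \<omega>
  define U where "U \<omega> = (\<lambda>k. u k \<omega>)" for \<omega>
  define E where "E \<omega> = (\<lambda>k. e k \<omega>)" for \<omega>
  define \<C> where "\<C> = {u l -` A \<inter> space M |A. A \<in> sets borel}"
  define \<G> where "\<G> = {(R -` A \<inter> space M) \<inter> (E -` B \<inter> space M) |A B. A \<in> sets (?P {..<l}) \<and> B \<in> sets ?Q}"
  have R: "indep_var (?P {l}) R1 (?P {..<l}) R"
    using indep_var_restrict[OF u, of "{l}" "{..<l}"] unfolding R_def R1_def by simp
  have UE: "U \<in> measurable M (?P UNIV)" "E \<in> measurable M ?Q"
    "indep_set (sigma_sets (space M) {U -` A \<inter> space M |A. A \<in> sets (?P UNIV)})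
       (sigma_sets (space M) {E -` A \<inter> space M |A. A \<in> sets ?Q})"
    using ue unfolding indep_pair_def U_def E_def by auto
  have R_meas: "R \<in> measurable M (?P {..<l})" "R1 \<in> measurable M (?P {l})"
    using indep_var_rv1[OF R] indep_var_rv2[OF R] by auto
  have u_meas: "random_variable borel (u k)" for k
    using u unfolding indep_vars_def by auto
  have \<C>R: "prob ((u l -` C \<inter> space M) \<inter> (R -` A \<inter> space M)) = prob (u l -` C \<inter> space M) * prob (R -` A \<inter> space M)"
    if "C \<in> sets borel" "A \<in> sets (?P {..<l})" for C A
  proof -
    let ?C = "(\<lambda>f. f l) -` C \<inter> space (?P {l})"
    have "?C \<in> sets (?P {l})"
      using that by (intro measurable_sets[OF measurable_component_singleton]) auto
    moreover have "u l -` C \<inter> space M = R1 -` ?C \<inter> space M"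
      by (auto simp: R1_def space_PiM)
    ultimately have "u l -` C \<inter> space M \<in> sigma_sets (space M) {R1 -` A \<inter> space M |A. A \<in> sets (?P {l})}"
      by blast
    moreover have "R -` A \<inter> space M \<in> sigma_sets (space M) {R -` A \<inter> space M |A. A \<in> sets (?P {..<l})}"
      using that by blast
    ultimately show ?thesis
      using R unfolding indep_var_eq indep_sets2_eq by blast
  qed
  have UE_prob: "prob ((U -` W \<inter> space M) \<inter> (E -` B \<inter> space M)) = prob (U -` W \<inter> space M) * prob (E -` B \<inter> space M)"
    if "W \<in> sets (?P UNIV)" "B \<in> sets ?Q" for W B
    using that by (intro indep_setD[OF UE(3)] sigma_sets.Basic) blast+
  \<comment> \<open>Events of the past and of time \<open>l\<close> are rewritten as events of the
    whole process \<open>U\<close>, the form in which independence from \<open>E\<close> is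
    available.\<close>
  have past_as_U: "R -` A \<inter> space M = U -` ((\<lambda>f. restrict f {..<l}) -` A \<inter> space (?P UNIV)) \<inter> space M" for A
    by (auto simp: R_def U_def space_PiM)
  have now_as_U: "u l -` C \<inter> space M = U -` ((\<lambda>f. f l) -` C \<inter> space (?P UNIV)) \<inter> space M" for C
    by (auto simp: U_def space_PiM)
  have in_U: "(\<lambda>f. restrict f {..<l}) -` A \<inter> space (?P UNIV) \<in> sets (?P UNIV)"
    if "A \<in> sets (?P {..<l})" for A
    using that by (intro measurable_sets[OF measurable_restrict_subset]) auto
  have in_U': "(\<lambda>f. f l) -` C \<inter> space (?P UNIV) \<in> sets (?P UNIV)" if "C \<in> sets borel" for C
    using that by (intro measurable_sets[OF measurable_component_singleton]) auto
  have "indep_set \<C> \<G>"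
  proof (rule indep_setI)
    show "\<C> \<subseteq> events"
      using u_meas unfolding \<C>_def by (auto intro: measurable_sets)
    show "\<G> \<subseteq> events"
      unfolding \<G>_def using measurable_sets[OF R_meas(1)] measurable_sets[OF UE(2)] by blast
    fix c g assume "c \<in> \<C>" "g \<in> \<G>"
    then obtain C A B where C: "C \<in> sets borel" "c = u l -` C \<inter> space M"
      and A: "A \<in> sets (?P {..<l})" and B: "B \<in> sets ?Q"
      and g: "g = (R -` A \<inter> space M) \<inter> (E -` B \<inter> space M)"
      unfolding \<C>_def \<G>_def by blast
    let ?a = "R -` A \<inter> space M" and ?b = "E -` B \<inter> space M"
    let ?W = "((\<lambda>f. f l) -` C \<inter> space (?P UNIV)) \<inter> ((\<lambda>f. restrict f {..<l}) -` A \<inter> space (?P UNIV))"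
    have ca: "c \<inter> ?a = U -` ?W \<inter> space M"
      unfolding C(2) past_as_U now_as_U by blast
    \<comment> \<open>The factorisation first splits off the error event \<open>?b\<close>, then
      separates \<open>c\<close> from the past event \<open>?a\<close>, and finally joins
      \<open>?a\<close> and \<open>?b\<close> again into \<open>g\<close>.\<close>
    have "prob (c \<inter> g) = prob ((U -` ?W \<inter> space M) \<inter> ?b)"
      unfolding g ca[symmetric] by (simp only: Int_assoc)
    also have "\<dots> = prob (c \<inter> ?a) * prob ?b"
      unfolding ca by (intro UE_prob sets.Int in_U in_U' A B C)
    also have "\<dots> = prob c * (prob ?a * prob ?b)"
      using \<C>R[OF C(1) A] C(2) by simp
    also have "prob ?a * prob ?b = prob g"
      unfolding g past_as_U by (intro UE_prob[symmetric] in_U A B)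
    finally show "prob (c \<inter> g) = prob c * prob g" .
  qed
  moreover have "Int_stable \<C>"
  proof (rule Int_stableI)
    fix a b assume "a \<in> \<C>" "b \<in> \<C>"
    then obtain A B where "a = u l -` A \<inter> space M" "b = u l -` B \<inter> space M" "A \<in> sets borel" "B \<in> sets borel"
      unfolding \<C>_def by blast
    then show "a \<inter> b \<in> \<C>"
      unfolding \<C>_def by (intro CollectI exI[of _ "A \<inter> B"]) auto
  qed
  moreover have "Int_stable \<G>"
  proof (rule Int_stableI)
    fix a b assume "a \<in> \<G>" "b \<in> \<G>"
    then obtain A B A' B' where "a = (R -` A \<inter> space M) \<inter> (E -` B \<inter> space M)"
      "b = (R -` A' \<inter> space M) \<inter> (E -` B' \<inter> space M)" "A \<in> sets (?P {..<l})" "A' \<in> sets (?P {..<l})"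
      "B \<in> sets ?Q" "B' \<in> sets ?Q"
      unfolding \<G>_def by blast
    then show "a \<inter> b \<in> \<G>"
      unfolding \<G>_def by (intro CollectI exI[of _ "A \<inter> A'"] exI[of _ "B \<inter> B'"]) auto
  qed
  ultimately have indep: "indep_set (sigma_sets (space M) \<C>) (sigma_sets (space M) \<G>)"
    by (rule indep_set_sigma_sets)
  define N where "N = sigma (space M) \<G>"
  have "\<G> \<subseteq> Pow (space M)" unfolding \<G>_def by blast
  then have N: "space N = space M" "sets N = sigma_sets (space M) \<G>"
    by (simp_all add: N_def)
  show thesis
  proof (rule that[OF N(1)])
    show "u k \<in> borel_measurable N" if "k < l" for k
    proof (rule measurableI)
      fix A :: "'b set" assume A: "A \<in> sets borel"
      let ?A = "(\<lambda>f. f k) -` A \<inter> space (?P {..<l})"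
      have "?A \<in> sets (?P {..<l})"
        using A that by (intro measurable_sets[OF measurable_component_singleton]) auto
      \<comment> \<open>The whole space as the second factor turns an event of \<open>u k\<close>
        alone into a rectangle.\<close>
      moreover have "u k -` A \<inter> space N = (R -` ?A \<inter> space M) \<inter> (E -` space ?Q \<inter> space M)"
        using that by (auto simp: N R_def E_def space_PiM)
      ultimately have "u k -` A \<inter> space N \<in> \<G>"
        unfolding \<G>_def by blast
      then show "u k -` A \<inter> space N \<in> sets N"
        unfolding N(2) by (rule sigma_sets.Basic)
    qed simp
    show "e k \<in> borel_measurable N" for k
    proof (rule measurableI)
      fix A :: "'c set" assume A: "A \<in> sets borel"
      let ?A = "(\<lambda>f. f k) -` A \<inter> space ?Q"
      have "?A \<in> sets ?Q"
        using A by (intro measurable_sets[OF measurable_component_singleton]) auto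
      moreover have "e k -` A \<inter> space N = (R -` space (?P {..<l}) \<inter> space M) \<inter> (E -` ?A \<inter> space M)"
        by (auto simp: N R_def E_def space_PiM)
      ultimately have "e k -` A \<inter> space N \<in> \<G>"
        unfolding \<G>_def by blast
      then show "e k -` A \<inter> space N \<in> sets N"
        unfolding N(2) by (rule sigma_sets.Basic)
    qed simp
    have "\<C> \<subseteq> sigma_sets (space M) \<C>" by blast
    then show "indep_set {u l -` A \<inter> space M |A. A \<in> sets borel} (sets N)"
      using indep unfolding indep_sets2_eq N(2) \<C>_def[symmetric] by blast
  qed
qed

end

section \<open>The weighted squared norm and its expected change in one step\<close>

definition weighted_sq :: "('n::finite \<Rightarrow> real) \<Rightarrow> 'a::real_inner^'n \<Rightarrow> real" where
  "weighted_sq p v = (\<Sum>i\<in>UNIV. (norm (v $ i))\<^sup>2 / p i)"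

lemma power2_norm_vec: "(norm v)\<^sup>2 = (\<Sum>i\<in>UNIV. (norm (v $ i))\<^sup>2)" for v :: "'a::real_inner^'n::finite"
  by (simp add: norm_vec_def L2_set_def sum_nonneg)

lemma weighted_sq_nonneg: "(\<And>i. p i > 0) \<Longrightarrow> weighted_sq p v \<ge> 0"
  unfolding weighted_sq_def by (intro sum_nonneg divide_nonneg_pos) auto

lemma weighted_sq_le:
  assumes "\<And>i. q \<le> p i" "q > 0"
  shows "weighted_sq p v \<le> (norm v)\<^sup>2 / q"
  unfolding weighted_sq_def power2_norm_vec sum_divide_distrib
  by (intro sum_mono divide_left_mono mult_pos_pos less_le_trans[OF assms(2,1)] assms) auto

text \<open>The triangle inequality is squared in each component, and only the terms containing
  \<open>d\<close> have their weight enlarged to \<open>1 / q\<close>. Thus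
  \<open>weighted_sq p v\<close> keeps the coefficient 1, which telescoping requires. Cauchy-Schwarz
  over the components bounds the cross terms.\<close>

lemma weighted_sq_add_le:
  fixes v d :: "'a::real_inner^'n::finite"
  assumes p: "\<And>i. q \<le> p i" "q > 0"
  shows "weighted_sq p (v + d) \<le> weighted_sq p v + (2 * norm v * norm d + (norm d)\<^sup>2) / q"
proof -
  have "(norm ((v + d) $ i))\<^sup>2 / p i \<le>
      (norm (v $ i))\<^sup>2 / p i + (2 * (norm (v $ i) * norm (d $ i)) + (norm (d $ i))\<^sup>2) / q" for i
  proof -
    have pi: "p i > 0" using p(1)[of i] p(2) by linarith
    have "(norm ((v + d) $ i))\<^sup>2 \<le> (norm (v $ i) + norm (d $ i))\<^sup>2"
      by (simp add: power_mono norm_triangle_ineq)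
    also have "\<dots> = (norm (v $ i))\<^sup>2 + (2 * (norm (v $ i) * norm (d $ i)) + (norm (d $ i))\<^sup>2)"
      by (simp add: power2_sum algebra_simps)
    finally have "(norm ((v + d) $ i))\<^sup>2 / p i \<le>
        (norm (v $ i))\<^sup>2 / p i + (2 * (norm (v $ i) * norm (d $ i)) + (norm (d $ i))\<^sup>2) / p i"
      using pi by (simp add: divide_right_mono flip: add_divide_distrib)
    also have "(2 * (norm (v $ i) * norm (d $ i)) + (norm (d $ i))\<^sup>2) / p i \<le>
        (2 * (norm (v $ i) * norm (d $ i)) + (norm (d $ i))\<^sup>2) / q"
      using p pi by (intro divide_left_mono mult_pos_pos) auto
    finally show ?thesis by simp
  qed
  then have "weighted_sq p (v + d) \<le>
      (\<Sum>i\<in>UNIV. (norm (v $ i))\<^sup>2 / p i + (2 * (norm (v $ i) * norm (d $ i)) + (norm (d $ i))\<^sup>2) / q)"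
    unfolding weighted_sq_def by (rule sum_mono)
  also have "\<dots> = weighted_sq p v + (2 * (\<Sum>i\<in>UNIV. norm (v $ i) * norm (d $ i)) + (norm d)\<^sup>2) / q"
    by (simp add: weighted_sq_def power2_norm_vec sum.distrib sum_distrib_left flip: sum_divide_distrib)
  also have "(\<Sum>i\<in>UNIV. norm (v $ i) * norm (d $ i)) \<le> norm v * norm d"
    using L2_set_mult_ineq[of "\<lambda>i. norm (v $ i)" "\<lambda>i. norm (d $ i)" UNIV] by (simp add: norm_vec_def)
  finally show ?thesis
    using p(2) by (simp add: divide_right_mono mult.assoc)
qed

context prob_space
begin

text \<open>The weights \<open>1 / p i\<close> compensate the update probabilities.\<close>

lemma expectation_weighted_sq_step:
  fixes u :: "'a \<Rightarrow> real^'n::finite" and X Y Z :: "'a \<Rightarrow> 'b::real_inner^'n"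
  assumes indep: "indep_set {u -` A \<inter> space M |A. A \<in> sets borel} (sets N)" "space N = space M"
    and u: "u \<in> borel_measurable M" "\<And>\<omega> i. \<omega> \<in> space M \<Longrightarrow> u \<omega> $ i \<in> {0, 1}"
    and p: "\<And>i. p i = prob {\<omega> \<in> space M. u \<omega> $ i = 1}" "\<And>i. p i > 0"
    and X: "X \<in> borel_measurable N" "integrable M (\<lambda>\<omega>. (norm (X \<omega>))\<^sup>2)"
    and Z: "Z \<in> borel_measurable N" "integrable M (\<lambda>\<omega>. (norm (Z \<omega>))\<^sup>2)"
    and Y: "\<And>\<omega> i. \<omega> \<in> space M \<Longrightarrow> Y \<omega> $ i = (1 - u \<omega> $ i) *\<^sub>R (X \<omega> $ i) + (u \<omega> $ i) *\<^sub>R (Z \<omega> $ i)"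
  shows "expectation (\<lambda>\<omega>. weighted_sq p (Y \<omega>)) =
           expectation (\<lambda>\<omega>. weighted_sq p (X \<omega>)) - expectation (\<lambda>\<omega>. (norm (X \<omega>))\<^sup>2)
           + expectation (\<lambda>\<omega>. (norm (Z \<omega>))\<^sup>2)"
proof -
  have sub: "subalgebra M N"
    using indep_setD_ev2[OF indep(1)] indep(2) by (simp add: subalgebra_def)
  have comp_meas: "(\<lambda>\<omega>. (norm (W \<omega> $ i))\<^sup>2) \<in> borel_measurable N"
    if "W \<in> borel_measurable N" for W :: "'a \<Rightarrow> 'b^'n" and i
    by (rule borel_measurable_continuous_on[OF continuous_on_power[OF continuous_on_norm
          [OF continuous_on_component[OF continuous_on_id]]] that])
  have comp_int: "integrable M (\<lambda>\<omega>. (norm (W \<omega> $ i))\<^sup>2)"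
    if "W \<in> borel_measurable N" "integrable M (\<lambda>\<omega>. (norm (W \<omega>))\<^sup>2)" for W :: "'a \<Rightarrow> 'b^'n" and i
    by (rule Bochner_Integration.integrable_bound[OF that(2) measurable_from_subalg[OF sub comp_meas[OF that(1)]]])
      (auto intro!: AE_I2 power_mono Finite_Cartesian_Product.norm_nth_le)
  have u_meas: "(\<lambda>\<omega>. u \<omega> $ i) \<in> borel_measurable M" for i
    by (rule borel_measurable_continuous_on[OF continuous_on_component[OF continuous_on_id] u(1)])
  have u_int: "integrable M (\<lambda>\<omega>. u \<omega> $ i)" for i
  proof (intro integrable_const_bound[of _ 1] u_meas AE_I2)
    show "norm (u \<omega> $ i) \<le> 1" if "\<omega> \<in> space M" for \<omega>
      using u(2)[OF that, of i] by auto
  qed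
  have u_exp: "expectation (\<lambda>\<omega>. u \<omega> $ i) = p i" for i
  proof -
    have "{\<omega> \<in> space M. u \<omega> $ i = 1} \<in> events"
      using u_meas[of i] by measurable
    moreover have "expectation (\<lambda>\<omega>. u \<omega> $ i) = expectation (indicator {\<omega> \<in> space M. u \<omega> $ i = 1})"
      using u(2) by (intro Bochner_Integration.integral_cong) (fastforce simp: indicator_def)+
    ultimately show ?thesis
      unfolding p(1) by simp
  qed
  have u_sets: "(\<lambda>\<omega>. u \<omega> $ i) -` A \<inter> space M \<in> {u -` A \<inter> space M |A. A \<in> sets borel}"
    if "A \<in> sets borel" for i A
  proof -
    have "(\<lambda>v :: real^'n. v $ i) \<in> borel_measurable borel"
      by (rule borel_measurable_continuous_onI[OF continuous_on_component[OF continuous_on_id]])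
    from measurable_sets[OF this that] have "(\<lambda>v :: real^'n. v $ i) -` A \<in> sets borel" by simp
    then show ?thesis by (auto simp: vimage_def)
  qed
  note mult = indep_set_expectation_mult[OF indep u_sets comp_meas u_int comp_int, simplified u_exp]
  define x z where "x i \<omega> = (norm (X \<omega> $ i))\<^sup>2" and "z i \<omega> = (norm (Z \<omega> $ i))\<^sup>2" for i \<omega>
  have int [simp]: "integrable M (x i)" "integrable M (z i)"
    "integrable M (\<lambda>\<omega>. u \<omega> $ i * x i \<omega>)" "integrable M (\<lambda>\<omega>. u \<omega> $ i * z i \<omega>)" for i
    unfolding x_def z_def using X Z by (auto intro: comp_int mult)
  have exp: "expectation (\<lambda>\<omega>. u \<omega> $ i * x i \<omega>) = p i * expectation (x i)"
    "expectation (\<lambda>\<omega>. u \<omega> $ i * z i \<omega>) = p i * expectation (z i)" for i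
    unfolding x_def z_def using X Z by (auto intro: mult)
  have "expectation (\<lambda>\<omega>. weighted_sq p (Y \<omega>)) =
      expectation (\<lambda>\<omega>. \<Sum>i\<in>UNIV. (x i \<omega> - u \<omega> $ i * x i \<omega> + u \<omega> $ i * z i \<omega>) / p i)"
  proof (intro Bochner_Integration.integral_cong refl)
    fix \<omega> assume \<omega>: "\<omega> \<in> space M"
    \<comment> \<open>Since \<open>u \<omega> $ i\<close> is 0 or 1, one of the two terms of
      \<open>Y \<omega> $ i\<close> vanishes; the squared norm is then linear in
      \<open>u \<omega> $ i\<close>, without a cross term.\<close>
    have "(norm (Y \<omega> $ i))\<^sup>2 = x i \<omega> - u \<omega> $ i * x i \<omega> + u \<omega> $ i * z i \<omega>" for i
      using u(2)[OF \<omega>, of i] Y[OF \<omega>, of i] by (auto simp: x_def z_def)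
    then show "weighted_sq p (Y \<omega>) = (\<Sum>i\<in>UNIV. (x i \<omega> - u \<omega> $ i * x i \<omega> + u \<omega> $ i * z i \<omega>) / p i)"
      by (simp add: weighted_sq_def)
  qed
  also have "\<dots> = (\<Sum>i\<in>UNIV. (expectation (x i) - p i * expectation (x i) + p i * expectation (z i)) / p i)"
    by (simp add: exp)
  \<comment> \<open>The factor \<open>p i\<close> from the expected update cancels the weight in the
    last two terms, which therefore sum to full unweighted squared norms.\<close>
  also have "\<dots> = (\<Sum>i\<in>UNIV. expectation (x i) / p i - expectation (x i) + expectation (z i))"
    using p(2) by (intro sum.cong refl) (simp add: add_divide_distrib diff_divide_distrib less_imp_neq[symmetric])
  also have "\<dots> = expectation (\<lambda>\<omega>. weighted_sq p (X \<omega>)) - expectation (\<lambda>\<omega>. (norm (X \<omega>))\<^sup>2)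
           + expectation (\<lambda>\<omega>. (norm (Z \<omega>))\<^sup>2)"
    by (simp add: weighted_sq_def power2_norm_vec sum.distrib sum_subtractf flip: x_def z_def)
  finally show ?thesis .
qed

end

section \<open>The averaged residual bound by telescoping along a path of fixed points\<close>

theorem proposition2:
  fixes V :: "'n::finite \<Rightarrow> 'a::real_inner set"
    and D :: "('a^'n) set"
    and T :: "nat \<Rightarrow> 'a^'n \<Rightarrow> 'a^'n"
    and \<alpha> \<sigma> \<nu> :: real
    and M :: "'w measure"
    and u :: "nat \<Rightarrow> 'w \<Rightarrow> real^'n"
    and e :: "nat \<Rightarrow> 'w \<Rightarrow> 'a^'n"
    and p :: "'n \<Rightarrow> real"
    and x0 :: "'a^'n"
    and x :: "nat \<Rightarrow> 'w \<Rightarrow> 'a^'n"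
  assumes V: "\<And>i. subspace (V i)" "\<And>i. Topological_Spaces.complete (V i)"
    and D: "D \<subseteq> hilbert_sum V" "convex D" "compact D"
    and T: "\<And>l. T l \<in> D \<rightarrow> D"
    and \<alpha>: "0 < \<alpha>" "\<alpha> < 1"
    and averaged: "\<And>l. averaged_on D \<alpha> (T l)"
    and \<sigma>: "\<sigma> \<ge> 0"
    and drift: "\<And>l xb. l \<ge> 1 \<Longrightarrow> xb \<in> fix_on D (T l) \<Longrightarrow>
                  (INF y\<in>fix_on D (T (l - 1)). norm (xb - y)) \<le> \<sigma>"
    and M: "prob_space M"
    and u_values: "\<And>l \<omega> i. \<omega> \<in> space M \<Longrightarrow> u l \<omega> $ i \<in> {0, 1}"
    and u_indep: "prob_space.indep_vars M (\<lambda>_. borel) u UNIV"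
    and u_ident: "\<And>l. distr M borel (u l) = distr M borel (u 0)"
    and p: "\<And>l i. p i = measure M {\<omega> \<in> space M. u l \<omega> $ i = 1}" "\<And>i. p i > 0"
    and e_values: "\<And>l \<omega>. \<omega> \<in> space M \<Longrightarrow> e l \<omega> \<in> hilbert_sum V"
    and e_indep: "prob_space.indep_vars M (\<lambda>_. borel) e UNIV"
    and e_ident: "\<And>l. distr M borel (e l) = distr M borel (e 0)"
    and \<nu>: "\<nu> \<ge> 0"
    and e_bound: "\<And>l. integrable M (\<lambda>\<omega>. (norm (e l \<omega>))\<^sup>2)"
                 "\<And>l. prob_space.expectation M (\<lambda>\<omega>. (norm (e l \<omega>))\<^sup>2) \<le> \<nu>\<^sup>2"
    and u_e_indep: "indep_pair M
                      (Pi\<^sub>M UNIV (\<lambda>_::nat. borel)) (\<lambda>\<omega> l. u l \<omega>)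
                      (Pi\<^sub>M UNIV (\<lambda>_::nat. borel)) (\<lambda>\<omega> l. e l \<omega>)"
    and x0: "x0 \<in> hilbert_sum V"
    and x_init: "\<And>\<omega>. \<omega> \<in> space M \<Longrightarrow> x 0 \<omega> = x0"
    and x_step: "\<And>l \<omega> i. \<omega> \<in> space M \<Longrightarrow>
                   x (l + 1) \<omega> $ i = (1 - u l \<omega> $ i) *\<^sub>R (x l \<omega> $ i)
                     + (u l \<omega> $ i) *\<^sub>R (T (l + 1) (x l \<omega>) $ i + e l \<omega> $ i)"
    and x_dom: "\<And>l \<omega>. \<omega> \<in> space M \<Longrightarrow> x l \<omega> \<in> D"
  shows "(\<exists>xbar. fix_path D T \<sigma> xbar) \<and>
         (\<forall>xbar. fix_path D T \<sigma> xbar \<longrightarrow>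
           (\<forall>l. integrable M (\<lambda>\<omega>. 1 / (real l + 1) *
                    (\<Sum>h=0..l. (norm (x h \<omega> - T (h + 1) (x h \<omega>)))\<^sup>2)) \<and>
                prob_space.expectation M (\<lambda>\<omega>. 1 / (real l + 1) *
                    (\<Sum>h=0..l. (norm (x h \<omega> - T (h + 1) (x h \<omega>)))\<^sup>2))
                \<le> \<alpha> / (Min (range p) * (1 - \<alpha>)) *
                   (1 / (real l + 1) * (norm (x0 - xbar 0))\<^sup>2 + \<sigma>\<^sup>2 + \<nu>\<^sup>2
                    + 2 * diameter D * (\<sigma> + \<nu>))))"
proof -
  interpret prob_space M by (rule M)
  define q d \<kappa> where "q = Min (range p)" and "d = diameter D" and "\<kappa> = (1 - \<alpha>) / \<alpha>"
  have q_le: "q \<le> p i" for i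
    unfolding q_def by (intro Min_le) auto
  have q_pos: "q > 0"
    unfolding q_def using p(2) by (subst Min_gr_iff) auto
  have "p i \<le> 1" for i
    unfolding p(1)[of i 0] by (rule prob_le_1)
  then have q_le_1: "q \<le> 1"
    using q_le order_trans by blast
  have \<kappa>: "\<kappa> > 0"
    using \<alpha> by (simp add: \<kappa>_def)
  have D_dist: "norm (y - z) \<le> d" if "y \<in> D" "z \<in> D" for y z
    using diameter_bounded_bound[OF compact_imp_bounded[OF D(3)] that] by (simp add: d_def dist_norm)
  \<comment> \<open>A probability space has a point and the iterates stay in \<open>D\<close>, so
    \<open>D\<close> is nonempty; the existence of fixed points rests on this.\<close>
  obtain \<omega>0 where "\<omega>0 \<in> space M"
    using not_empty by blast
  then have "D \<noteq> {}"
    using x_dom by blast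
  have d_nonneg: "d \<ge> 0"
    unfolding d_def by (rule diameter_ge_0[OF compact_imp_bounded[OF D(3)]])
  have T_lip: "1-lipschitz_on D (T l)" for l
    by (rule averaged_on_nonexpansive[OF averaged \<alpha>])
  have T_cont: "continuous_on D (T l)" for l
    by (rule lipschitz_on_continuous_on[OF T_lip])
  have u_meas: "random_variable borel (u l)" and e_meas: "random_variable borel (e l)" for l
    using u_indep e_indep unfolding indep_vars_def by auto
  have x_into: "x l \<in> space M \<rightarrow> D" for l
    using x_dom by blast
  \<comment> \<open>The \<sigma>-algebra is left general: the claim serves both for \<open>M\<close>
    itself and for the smaller one supplied by \<open>past_independent\<close>.\<close>
  have x_meas: "x l \<in> borel_measurable N"
    if "space N = space M" "\<And>k. k < l \<Longrightarrow> u k \<in> borel_measurable N" "\<And>k. e k \<in> borel_measurable N" for l N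
    using that(2)
  proof (induction l)
    case 0
    show ?case
      using x_init that(1) by (subst measurable_cong[where g = "\<lambda>_. x0"]) auto
  next
    case (Suc l)
    show ?case
    proof (rule borel_measurable_async_step[OF D(3) T_cont Suc.IH _ Suc.prems _ that(3)])
      show "x (Suc l) \<omega> $ i = (1 - u l \<omega> $ i) *\<^sub>R (x l \<omega> $ i) + (u l \<omega> $ i) *\<^sub>R (T (Suc l) (x l \<omega>) $ i + e l \<omega> $ i)"
        if "\<omega> \<in> space N" for \<omega> i
        using x_step[of \<omega> l i] that \<open>space N = space M\<close> by simp
    qed (use Suc.prems u_values x_into that(1) in auto)
  qed
  have xM: "x l \<in> borel_measurable M" for l
    by (rule x_meas[OF refl u_meas e_meas])
  have x_int: "integrable M (\<lambda>\<omega>. f (x l \<omega>))" if "continuous_on D f" for f :: "'a^'n \<Rightarrow> real" and l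
    by (rule integrable_continuous_on_compact[OF D(3) that xM x_into])
  note e_norm = expectation_norm_le[OF e_meas e_bound \<nu>]
  define r where "r h \<omega> = (norm (x h \<omega> - T (h + 1) (x h \<omega>)))\<^sup>2" for h \<omega>
  have r_int: "integrable M (r h)" for h
    unfolding r_def by (intro x_int continuous_intros T_cont)
  have w_cont: "continuous_on A (\<lambda>y. weighted_sq p (y - w))" for A and w :: "'a^'n"
    unfolding weighted_sq_def divide_inverse by (intro continuous_intros)

  have bound: "expectation (\<lambda>\<omega>. 1 / (real l + 1) * (\<Sum>h=0..l. r h \<omega>)) \<le> \<alpha> / (q * (1 - \<alpha>)) *
      (1 / (real l + 1) * (norm (x0 - xbar 0))\<^sup>2 + \<sigma>\<^sup>2 + \<nu>\<^sup>2 + 2 * d * (\<sigma> + \<nu>))"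
    if path: "fix_path D T \<sigma> xbar" for xbar l
  proof -
    have xbar: "xbar k \<in> D" "T k (xbar k) = xbar k" "norm (xbar (Suc k) - xbar k) \<le> \<sigma>" for k
      using path unfolding fix_path_def fix_on_def by (fastforce dest: spec[of _ k] spec[of _ "Suc k"])+
    define \<Phi> where "\<Phi> k = expectation (\<lambda>\<omega>. weighted_sq p (x k \<omega> - xbar k))" for k
    define c where "c = (\<sigma>\<^sup>2 + \<nu>\<^sup>2 + 2 * d * (\<sigma> + \<nu>)) / q"
    have step: "\<Phi> (Suc k) + \<kappa> * expectation (r k) \<le> \<Phi> k + c" for k
    proof -
      \<comment> \<open>The operator applied at step \<open>k\<close> is \<open>T (Suc k)\<close>,
        so its fixed point \<open>w\<close> is the reference point for the step, whereas
        \<open>\<Phi> k\<close> measures from \<open>xbar k\<close>. The change of reference is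
        accounted for separately.\<close>
      define w where "w = xbar (Suc k)"
      define Z where "Z \<omega> = T (Suc k) (x k \<omega>) + e k \<omega> - w" for \<omega>
      obtain N where N: "space N = space M" "\<And>j. j < k \<Longrightarrow> u j \<in> borel_measurable N"
        "\<And>j. e j \<in> borel_measurable N" "indep_set {u k -` A \<inter> space M |A. A \<in> sets borel} (sets N)"
        by (rule past_independent[OF u_indep u_e_indep, of k]) (rule that, simp_all)
      have xN: "x k \<in> borel_measurable N"
        by (rule x_meas[OF N(1-3)])
      have sub: "subalgebra M N"
        using indep_setD_ev2[OF N(4)] N(1) by (simp add: subalgebra_def)
      have XN: "(\<lambda>\<omega>. x k \<omega> - w) \<in> borel_measurable N"
        by (rule borel_measurable_continuous_on[OF continuous_on_diff[OF continuous_on_id continuous_on_const] xN])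
      have TxN: "(\<lambda>\<omega>. T (Suc k) (x k \<omega>)) \<in> borel_measurable N"
        by (rule borel_measurable_compose_on[OF T_cont xN]) (simp add: N(1) x_into)
      have "(\<lambda>\<omega>. e k \<omega> + T (Suc k) (x k \<omega>)) \<in> borel_measurable N"
        by (rule borel_measurable_add_compact[OF N(3) TxN compact_continuous_image[OF T_cont D(3)]])
          (use x_into[of k] N(1) in auto)
      then have ZN: "Z \<in> borel_measurable N"
        unfolding Z_def add.commute[of "T (Suc k) (x k _)"]
        by (rule borel_measurable_continuous_on[OF continuous_on_diff[OF continuous_on_id continuous_on_const]])
      \<comment> \<open>\<open>Z \<omega>\<close> is \<open>T (Suc k) (x k \<omega>) - w\<close>
        plus the error. The first part joins two points of \<open>D\<close>, so \<open>d\<close>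
        bounds it in the cross term; its square is bounded by averagedness, using that
        \<open>T (Suc k)\<close> fixes \<open>w\<close>.\<close>
      have Z_le: "(norm (Z \<omega>))\<^sup>2 \<le>
          (norm (x k \<omega> - w))\<^sup>2 - \<kappa> * r k \<omega> + 2 * d * norm (e k \<omega>) + (norm (e k \<omega>))\<^sup>2"
        if "\<omega> \<in> space M" for \<omega>
      proof -
        let ?t = "T (Suc k) (x k \<omega>) - w"
        have tD: "T (Suc k) (x k \<omega>) \<in> D" "w \<in> D" "x k \<omega> \<in> D"
          using T x_dom[OF that] xbar(1) by (auto simp: w_def)
        have "norm (Z \<omega>) \<le> norm ?t + norm (e k \<omega>)"
          using norm_triangle_ineq[of ?t "e k \<omega>"] by (simp add: Z_def algebra_simps)
        then have "(norm (Z \<omega>))\<^sup>2 \<le> (norm ?t + norm (e k \<omega>))\<^sup>2"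
          by (rule power_mono) simp
        also have "\<dots> = (norm ?t)\<^sup>2 + 2 * norm ?t * norm (e k \<omega>) + (norm (e k \<omega>))\<^sup>2"
          by (simp add: power2_sum)
        also have "2 * norm ?t * norm (e k \<omega>) \<le> 2 * d * norm (e k \<omega>)"
          using D_dist[OF tD(1,2)] by (intro mult_right_mono) auto
        also have "(norm ?t)\<^sup>2 \<le> (norm (x k \<omega> - w))\<^sup>2 - \<kappa> * r k \<omega>"
          using averaged_on_norm_le[OF averaged \<alpha> tD(3,2), of "Suc k"] xbar(2)[of "Suc k"]
          by (simp add: w_def r_def \<kappa>_def)
        finally show ?thesis by simp
      qed
      have X_int: "integrable M (\<lambda>\<omega>. (norm (x k \<omega> - w))\<^sup>2)"
        by (intro x_int continuous_intros)
      have Z_bound_int: "integrable M (\<lambda>\<omega>.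
          (norm (x k \<omega> - w))\<^sup>2 - \<kappa> * r k \<omega> + 2 * d * norm (e k \<omega>) + (norm (e k \<omega>))\<^sup>2)"
        using X_int r_int e_norm(1) e_bound(1) by simp
      have "(\<lambda>\<omega>. (norm (Z \<omega>))\<^sup>2) \<in> borel_measurable M"
        by (rule borel_measurable_continuous_on[OF continuous_on_power[OF continuous_on_norm_id]
              measurable_from_subalg[OF sub ZN]])
      then have Z_int: "integrable M (\<lambda>\<omega>. (norm (Z \<omega>))\<^sup>2)"
        by (rule Bochner_Integration.integrable_bound[OF Z_bound_int])
          (use Z_le in \<open>force intro!: AE_I2\<close>)
      have "\<Phi> (Suc k) = expectation (\<lambda>\<omega>. weighted_sq p (x k \<omega> - w)) - expectation (\<lambda>\<omega>. (norm (x k \<omega> - w))\<^sup>2)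
           + expectation (\<lambda>\<omega>. (norm (Z \<omega>))\<^sup>2)"
        unfolding \<Phi>_def
      proof (rule expectation_weighted_sq_step[OF N(4,1) u_meas u_values p XN X_int ZN Z_int])
        \<comment> \<open>The coefficients \<open>1 - u\<close> and \<open>u\<close> add up to 1, so
          centring at \<open>w\<close> is compatible with the partial update.\<close>
        show "(x (Suc k) \<omega> - xbar (Suc k)) $ i = (1 - u k \<omega> $ i) *\<^sub>R (x k \<omega> - w) $ i + u k \<omega> $ i *\<^sub>R Z \<omega> $ i"
          if "\<omega> \<in> space M" for \<omega> i
          using x_step[OF that, of k i] by (simp add: w_def Z_def algebra_simps)
      qed
      moreover have "expectation (\<lambda>\<omega>. (norm (Z \<omega>))\<^sup>2) \<le>
          expectation (\<lambda>\<omega>. (norm (x k \<omega> - w))\<^sup>2) - \<kappa> * expectation (r k) + 2 * d * \<nu> + \<nu>\<^sup>2"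
      proof -
        have "expectation (\<lambda>\<omega>. (norm (Z \<omega>))\<^sup>2) \<le> expectation (\<lambda>\<omega>.
          (norm (x k \<omega> - w))\<^sup>2 - \<kappa> * r k \<omega> + 2 * d * norm (e k \<omega>) + (norm (e k \<omega>))\<^sup>2)"
          by (rule integral_mono[OF Z_int Z_bound_int Z_le])
        also have "\<dots> = expectation (\<lambda>\<omega>. (norm (x k \<omega> - w))\<^sup>2) - \<kappa> * expectation (r k)
            + 2 * d * expectation (\<lambda>\<omega>. norm (e k \<omega>)) + expectation (\<lambda>\<omega>. (norm (e k \<omega>))\<^sup>2)"
          using X_int r_int e_norm(1) e_bound(1) by simp
        also have "2 * d * expectation (\<lambda>\<omega>. norm (e k \<omega>)) \<le> 2 * d * \<nu>"
          using e_norm(2) d_nonneg by (intro mult_left_mono) auto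
        finally show ?thesis
          using e_bound(2)[of k] by linarith
      qed
      \<comment> \<open>This is the cost of moving the reference point from \<open>xbar k\<close> to
        \<open>w\<close>: the displacement is at most \<open>\<sigma>\<close> and the iterate is
        within \<open>d\<close> of \<open>xbar k\<close>.\<close>
      moreover have "expectation (\<lambda>\<omega>. weighted_sq p (x k \<omega> - w)) \<le> \<Phi> k + (2 * d * \<sigma> + \<sigma>\<^sup>2) / q"
      proof -
        have "weighted_sq p (x k \<omega> - w) \<le> weighted_sq p (x k \<omega> - xbar k) + (2 * d * \<sigma> + \<sigma>\<^sup>2) / q"
          if "\<omega> \<in> space M" for \<omega>
        proof -
          have n: "norm (x k \<omega> - xbar k) \<le> d" "norm (xbar k - w) \<le> \<sigma>"
            using D_dist[OF x_dom[OF that] xbar(1)] xbar(3)[of k] by (simp_all add: w_def norm_minus_commute)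
          have "weighted_sq p (x k \<omega> - w) \<le> weighted_sq p (x k \<omega> - xbar k)
              + (2 * norm (x k \<omega> - xbar k) * norm (xbar k - w) + (norm (xbar k - w))\<^sup>2) / q"
            using weighted_sq_add_le[OF q_le q_pos, where v = "x k \<omega> - xbar k" and d = "xbar k - w"] by simp
          also have "\<dots> \<le> weighted_sq p (x k \<omega> - xbar k) + (2 * d * \<sigma> + \<sigma>\<^sup>2) / q"
            using n d_nonneg q_pos
            by (intro add_left_mono divide_right_mono add_mono mult_mono power_mono) auto
          finally show ?thesis .
        qed
        then have "expectation (\<lambda>\<omega>. weighted_sq p (x k \<omega> - w)) \<le>
            expectation (\<lambda>\<omega>. weighted_sq p (x k \<omega> - xbar k) + (2 * d * \<sigma> + \<sigma>\<^sup>2) / q)"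
          by (intro integral_mono Bochner_Integration.integrable_add integrable_const x_int w_cont)
        also have "\<dots> = \<Phi> k + (2 * d * \<sigma> + \<sigma>\<^sup>2) / q"
          unfolding \<Phi>_def
          by (subst Bochner_Integration.integral_add) (auto intro!: x_int w_cont simp: prob_space)
        finally show ?thesis .
      qed
      \<comment> \<open>The error cost arises unweighted; \<open>q \<le> 1\<close> allows it to be
        charged at the same rate \<open>1 / q\<close> as the drift, giving the common constant
        \<open>c\<close>.\<close>
      moreover have "2 * d * \<nu> + \<nu>\<^sup>2 \<le> (2 * d * \<nu> + \<nu>\<^sup>2) / q"
        using q_pos q_le_1 d_nonneg \<nu> by (simp add: le_divide_eq mult_left_le)
      moreover have "c = (2 * d * \<sigma> + \<sigma>\<^sup>2) / q + (2 * d * \<nu> + \<nu>\<^sup>2) / q"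
        by (simp add: c_def algebra_simps add_divide_distrib)
      ultimately show ?thesis by linarith
    qed
    \<comment> \<open>The choice \<open>k = Suc l\<close> produces exactly the \<open>l + 1\<close>
      residuals of the claim; the remaining \<open>\<Phi> (Suc l)\<close> is then dropped by
      nonnegativity.\<close>
    have "\<Phi> k + \<kappa> * (\<Sum>h<k. expectation (r h)) \<le> \<Phi> 0 + real k * c" for k
    proof (induction k)
      case (Suc k)
      then show ?case using step[of k] by (simp add: algebra_simps)
    qed simp
    moreover have "\<Phi> (Suc l) \<ge> 0"
      unfolding \<Phi>_def by (intro Bochner_Integration.integral_nonneg weighted_sq_nonneg p(2))
    moreover have "\<Phi> 0 \<le> (norm (x0 - xbar 0))\<^sup>2 / q"
    proof -
      have "\<Phi> 0 = expectation (\<lambda>\<omega>. weighted_sq p (x0 - xbar 0))"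
        unfolding \<Phi>_def using x_init by (intro Bochner_Integration.integral_cong) auto
      then show ?thesis
        using weighted_sq_le[OF q_le q_pos] by (simp add: prob_space)
    qed
    ultimately have "\<kappa> * (\<Sum>h<Suc l. expectation (r h)) \<le> (norm (x0 - xbar 0))\<^sup>2 / q + (real l + 1) * c"
      by (smt (verit, best) of_nat_Suc)
    then have "(\<Sum>h<Suc l. expectation (r h)) \<le> ((norm (x0 - xbar 0))\<^sup>2 / q + (real l + 1) * c) / \<kappa>"
      using \<kappa> by (simp add: pos_le_divide_eq mult.commute)
    then have "1 / (real l + 1) * (\<Sum>h<Suc l. expectation (r h)) \<le>
        1 / (real l + 1) * (((norm (x0 - xbar 0))\<^sup>2 / q + (real l + 1) * c) / \<kappa>)"
      by (intro mult_left_mono) auto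
    \<comment> \<open>Averaging reduces \<open>(l + 1) * c\<close> to \<open>c\<close>, and dividing
      by \<open>\<kappa>\<close> and \<open>q\<close> yields the leading factor.\<close>
    also have "\<dots> = \<alpha> / (q * (1 - \<alpha>)) *
        (1 / (real l + 1) * (norm (x0 - xbar 0))\<^sup>2 + (\<sigma>\<^sup>2 + \<nu>\<^sup>2 + 2 * d * (\<sigma> + \<nu>)))"
    proof -
      have "real l + 1 \<noteq> 0" "q \<noteq> 0" "1 - \<alpha> \<noteq> 0" "\<alpha> \<noteq> 0"
        using q_pos \<alpha> by auto
      then show ?thesis
        unfolding c_def \<kappa>_def
        by (simp add: divide_simps)
    qed
    finally show ?thesis
      using r_int by (simp add: atLeast0AtMost lessThan_Suc_atMost add.assoc)
  qed
  have "\<exists>xbar. fix_path D T \<sigma> xbar"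
    by (rule fix_path_exists[where T = T and D = D, OF D(3,2) \<open>D \<noteq> {}\<close> T_lip T drift])
  then show ?thesis
    using bound r_int unfolding r_def q_def d_def by simp
qed

end
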